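(* Let $n\geq 3$ be an integer. Then $$\sum_{\sigma\in D_n}x^{\mathrm{oDmaj}(\sigma)}y^{\mathrm{odes}_D(\sigma)}z^{\mathrm{oneg}_D(\sigma)}=\frac{n!}{2^{\lfloor n/2\rfloor}}(1+2zx+yx^{n})^{p_n}\prod_{j=1}^{\lfloor (n-1)/2\rfloor}(1+3xz+3yx^{2j}+yzx^{2j+1}),$$ and $$\sum_{\sigma\in D_n}x^{\mathrm{eDmaj}(\sigma)}y^{\mathrm{edes}_D(\sigma)}z^{\mathrm{eneg}_D(\sigma)}=\frac{n!}{2^{\lfloor (n-1)/2\rfloor}}(1+y)\left(1+2zx+yx^{n-1}\right)^{p_{n+1}}\prod_{j=1}^{\lfloor (n-2)/2\rfloor}(1+3zx+3yx^{2j}+yzx^{2j+1}).$$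
   Context: $B_n$ is the hyperoctahedral group: the group of bijections $\sigma$ of $\{-n,\dots,-1,1,\dots,n\}$ with $\sigma(-i)=-\sigma(i)$ for all $i$, written in window notation $[\sigma(1),\dots,\sigma(n)]$. For $\sigma\in B_n$ put $\sigma(0)=0$ and let $D(\sigma)=\{i\in\{0,1,\dots,n-1\}:\sigma(i)>\sigma(i+1)\}$ and $\mathrm{Neg}(\sigma)=\{i\in\{1,\dots,n\}:\sigma(i)<0\}$. $D_n=\{\sigma\in B_n:|\mathrm{Neg}(\sigma)|\text{ is even}\}$. For a set $J$ of integers, $J_o$ and $J_e$ denote its subsets of odd, respectively even, elements ($0$ is even). On $B_n$ define $\mathrm{odes}(\sigma)=|D(\sigma)_o|$, $\mathrm{edes}(\sigma)=|D(\sigma)_e|$, $\mathrm{omaj}(\sigma)=\sum_{i\in D(\sigma)_o}\frac{i+1}{2}$, $\mathrm{emaj}(\sigma)=\sum_{i\in D(\sigma)_e}\frac{i}{2}$, $\mathrm{oneg}(\sigma)=|\mathrm{Neg}(\sigma)_o|$, $\mathrm{eneg}(\sigma)=|\mathrm{Neg}(\sigma)_e|$, $\mathrm{ofmaj}(\sigma)=2\,\mathrm{omaj}(\sigma)+\mathrm{oneg}(\sigma)$, $\mathrm{efmaj}(\sigma)=2\,\mathrm{emaj}(\sigma)+\mathrm{eneg}(\sigma)$. For $\sigma\in B_n$ let $|\sigma|_n=[\sigma(1),\dots,\sigma(n-1),|\sigma(n)|]\in B_n$ and define $\mathrm{oDmaj}(\sigma)=\mathrm{ofmaj}(|\sigma|_n)$,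 $\mathrm{eDmaj}(\sigma)=\mathrm{efmaj}(|\sigma|_n)$, $\mathrm{odes}_D(\sigma)=\mathrm{odes}(|\sigma|_n)$, $\mathrm{edes}_D(\sigma)=\mathrm{edes}(|\sigma|_n)$, $\mathrm{oneg}_D(\sigma)=\mathrm{oneg}(|\sigma|_n)$, $\mathrm{eneg}_D(\sigma)=\mathrm{eneg}(|\sigma|_n)$ (the right-hand sides are the values at $|\sigma|_n\in B_n$ of the functions $\mathrm{ofmaj},\mathrm{efmaj},\mathrm{odes},\mathrm{edes},\mathrm{oneg},\mathrm{eneg}$ defined on $B_n$, computed from $D(|\sigma|_n)$ and $\mathrm{Neg}(|\sigma|_n)$ with the convention that the value at $0$ is $0$). For an integer $k$, $p_k=(1+(-1)^k)/2$. Empty products equal $1$. *)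

theory Defs
  imports Complex_Main "HOL-Combinatorics.Permutations"
begin

text \<open>
  A signed permutation is a function on all of \<open>int\<close> that is the identity outside
  \<open>{-n, ..., -1, 1, ..., n}\<close>. In particular \<open>\<sigma> 0 = 0\<close>, which is the convention used for descents
  at position 0.
\<close>
definition hyperoctahedral :: "nat \<Rightarrow> (int \<Rightarrow> int) set" where
  "hyperoctahedral n = {\<sigma>. \<sigma> permutes ({- int n..int n} - {0}) \<and> (\<forall>i. \<sigma> (- i) = - \<sigma> i)}"

definition Des :: "nat \<Rightarrow> (int \<Rightarrow> int) \<Rightarrow> nat set" where
  "Des n \<sigma> = {i \<in> {0..<n}. \<sigma> (int i) > \<sigma> (int (i + 1))}"

definition Neg :: "nat \<Rightarrow> (int \<Rightarrow> int) \<Rightarrow> nat set" where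
  "Neg n \<sigma> = {i \<in> {1..n}. \<sigma> (int i) < 0}"

definition even_signed :: "nat \<Rightarrow> (int \<Rightarrow> int) set" where
  "even_signed n = {\<sigma> \<in> hyperoctahedral n. even (card (Neg n \<sigma>))}"

definition odd_part :: "nat set \<Rightarrow> nat set" where
  "odd_part J = {i \<in> J. odd i}"

definition even_part :: "nat set \<Rightarrow> nat set" where
  "even_part J = {i \<in> J. even i}"

definition odes :: "nat \<Rightarrow> (int \<Rightarrow> int) \<Rightarrow> nat" where
  "odes n \<sigma> = card (odd_part (Des n \<sigma>))"

definition edes :: "nat \<Rightarrow> (int \<Rightarrow> int) \<Rightarrow> nat" where
  "edes n \<sigma> = card (even_part (Des n \<sigma>))"

definition omaj :: "nat \<Rightarrow> (int \<Rightarrow> int) \<Rightarrow> nat" where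
  "omaj n \<sigma> = (\<Sum>i \<in> odd_part (Des n \<sigma>). (i + 1) div 2)"

definition emaj :: "nat \<Rightarrow> (int \<Rightarrow> int) \<Rightarrow> nat" where
  "emaj n \<sigma> = (\<Sum>i \<in> even_part (Des n \<sigma>). i div 2)"

definition oneg :: "nat \<Rightarrow> (int \<Rightarrow> int) \<Rightarrow> nat" where
  "oneg n \<sigma> = card (odd_part (Neg n \<sigma>))"

definition eneg :: "nat \<Rightarrow> (int \<Rightarrow> int) \<Rightarrow> nat" where
  "eneg n \<sigma> = card (even_part (Neg n \<sigma>))"

definition ofmaj :: "nat \<Rightarrow> (int \<Rightarrow> int) \<Rightarrow> nat" where
  "ofmaj n \<sigma> = 2 * omaj n \<sigma> + oneg n \<sigma>"

definition efmaj :: "nat \<Rightarrow> (int \<Rightarrow> int) \<Rightarrow> nat" where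
  "efmaj n \<sigma> = 2 * emaj n \<sigma> + eneg n \<sigma>"

text \<open>
  The signed permutation with window \<open>[\<sigma> 1, ..., \<sigma> (n - 1), \<bar>\<sigma> n\<bar>]\<close>; the value at \<open>- n\<close> is
  changed as well, so that the function stays odd.
\<close>
definition abs_last :: "nat \<Rightarrow> (int \<Rightarrow> int) \<Rightarrow> (int \<Rightarrow> int)" where
  "abs_last n \<sigma> = \<sigma>(int n := \<bar>\<sigma> (int n)\<bar>, - int n := - \<bar>\<sigma> (int n)\<bar>)"

definition oDmaj :: "nat \<Rightarrow> (int \<Rightarrow> int) \<Rightarrow> nat" where
  "oDmaj n \<sigma> = ofmaj n (abs_last n \<sigma>)"

definition eDmaj :: "nat \<Rightarrow> (int \<Rightarrow> int) \<Rightarrow> nat" where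
  "eDmaj n \<sigma> = efmaj n (abs_last n \<sigma>)"

definition odes_D :: "nat \<Rightarrow> (int \<Rightarrow> int) \<Rightarrow> nat" where
  "odes_D n \<sigma> = odes n (abs_last n \<sigma>)"

definition edes_D :: "nat \<Rightarrow> (int \<Rightarrow> int) \<Rightarrow> nat" where
  "edes_D n \<sigma> = edes n (abs_last n \<sigma>)"

definition oneg_D :: "nat \<Rightarrow> (int \<Rightarrow> int) \<Rightarrow> nat" where
  "oneg_D n \<sigma> = oneg n (abs_last n \<sigma>)"

definition eneg_D :: "nat \<Rightarrow> (int \<Rightarrow> int) \<Rightarrow> nat" where
  "eneg_D n \<sigma> = eneg n (abs_last n \<sigma>)"

text \<open>The number \<open>(1 + (-1)^k) / 2\<close>, as a natural number because it is used as an exponent.\<close>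
definition parity_exp :: "nat \<Rightarrow> nat" where
  "parity_exp k = nat ((1 + (- 1) ^ k) div 2)"

text \<open>A sum over an infinite set would be 0, so finiteness is recorded here.\<close>
lemma finite_hyperoctahedral: "finite (hyperoctahedral n)"
  by (rule finite_subset[OF _ finite_permutations[of "{- int n..int n} - {0}"]])
     (auto simp: hyperoctahedral_def)

lemma finite_even_signed: "finite (even_signed n)"
  using finite_hyperoctahedral by (simp add: even_signed_def)

end

theory Submission
  imports Defs
begin

text \<open>
  The statistics of a signed permutation \<open>\<tau>\<close> that look only at odd positions, or only at even ones,
  turn the monomial of \<open>\<tau>\<close> into a product of weights, one for each position \<open>i\<close> of the chosen parity:
  a descent at \<open>i\<close> contributes a power of \<open>x\<close> times \<open>y\<close>, a negative entry at \<open>i\<close> contributes \<open>x * z\<close>.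
  The weight of \<open>i\<close> depends only on \<open>\<tau> i\<close> and \<open>\<tau> (i + 1)\<close>, and for positions of one parity the blocks
  \<open>{i, i + 1}\<close> are disjoint. So for a uniformly random \<open>\<tau>\<close> the weights behave like independent
  random variables, and the sum of the products is the number of signed permutations times the
  product of the average weights.

  The independence is made precise by symmetry. Permuting and negating the two entries of one block
  (a copy of the group \<open>B\<^sub>2\<close>, with eight elements) maps \<open>B\<^sub>n\<close> bijectively to itself and does
  not affect the weights of the other blocks, while the sum of the weight over the eight
  rearrangements is the same for every \<open>\<tau>\<close> (\<open>sum_block_moves\<close>). Lemma
  \<open>sum_prod_local_average\<close> then replaces the weights by their averages one at a time. If \<open>\<bar>a\<bar>\<close> and
  \<open>\<bar>b\<bar>\<close> are the two absolute values in a block, then of the eight arrangements one has neither a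
  descent nor a negative first entry, three have only a descent, three have only a negative first
  entry, and one has both; this gives the factors of the product over \<open>j\<close>. Position 0, where the value
  is always 0, leaves only the sign of the first entry to choose and gives the factor \<open>1 + y\<close>.

  The passage from \<open>D\<^sub>n\<close> to \<open>B\<^sub>n\<close> costs a factor 2: the sign of the last entry is forgotten by
  \<open>abs_last\<close>, and changing it exchanges \<open>D\<^sub>n\<close> with its complement
  (\<open>sum_even_signed_abs_last\<close>). Forgetting that sign is also what makes the block containing the
  last position special. With \<open>2\<^sup>n n!\<close> elements in \<open>B\<^sub>n\<close>, it remains to collect powers of 2.
\<close>

section \<open>Averaging a product of local weights\<close>

text \<open>
  Independence by symmetry: averaging over the moves of \<open>i\<close> preserves the sum over \<open>S\<close> and all factors
  other than \<open>w i\<close>, and turns \<open>w i\<close> into the constant \<open>\<mu> i\<close>. Lists of moves are used instead of sets, so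
  that it never has to be checked that the moves are pairwise distinct functions.
\<close>
lemma sum_prod_local_average:
  fixes w :: "'i \<Rightarrow> 's \<Rightarrow> 'a :: field_char_0" and moves :: "'i \<Rightarrow> ('s \<Rightarrow> 's) list"
  assumes "finite J"
    and bij: "\<And>i g. i \<in> J \<Longrightarrow> g \<in> set (moves i) \<Longrightarrow> bij_betw g S S"
    and local: "\<And>i k g s. i \<in> J \<Longrightarrow> k \<in> J \<Longrightarrow> k \<noteq> i \<Longrightarrow> g \<in> set (moves i) \<Longrightarrow> s \<in> S
                  \<Longrightarrow> w k (g s) = w k s"
    and nonempty: "\<And>i. i \<in> J \<Longrightarrow> moves i \<noteq> []"
    and average: "\<And>i s. i \<in> J \<Longrightarrow> s \<in> S
                  \<Longrightarrow> (\<Sum>g\<leftarrow>moves i. w i (g s)) = of_nat (length (moves i)) * \<mu> i"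
  shows "(\<Sum>s\<in>S. \<Prod>i\<in>J. w i s) = of_nat (card S) * (\<Prod>i\<in>J. \<mu> i)"
  using assms
proof (induction J rule: finite_induct)
  case empty
  then show ?case by simp
next
  case (insert i J)
  define F where "F s = (\<Prod>k\<in>J. w k s)" for s
  have move: "(\<Sum>s\<in>S. w i s * F s) = (\<Sum>s\<in>S. w i (g s) * F s)" if g: "g \<in> set (moves i)" for g
  proof -
    have "(\<Sum>s\<in>S. w i s * F s) = (\<Sum>s\<in>S. w i (g s) * F (g s))"
      using sum.reindex_bij_betw[OF insert.prems(1)[of i g], of "\<lambda>s. w i s * F s"] g by simp
    also have "\<dots> = (\<Sum>s\<in>S. w i (g s) * F s)"
    proof (rule sum.cong[OF refl])
      fix s assume "s \<in> S"
      then have "F (g s) = F s"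
        unfolding F_def using insert.hyps g by (intro prod.cong[OF refl] insert.prems(2)[of i]) auto
      then show "w i (g s) * F (g s) = w i (g s) * F s" by simp
    qed
    finally show ?thesis .
  qed
  have "of_nat (length (moves i)) * (\<Sum>s\<in>S. w i s * F s)
        = (\<Sum>g\<leftarrow>moves i. \<Sum>s\<in>S. w i s * F s)"
    by (simp add: sum_list_triv)
  also have "\<dots> = (\<Sum>g\<leftarrow>moves i. \<Sum>s\<in>S. w i (g s) * F s)"
    using move by (metis (mono_tags, lifting) map_cong)
  also have "\<dots> = (\<Sum>s\<in>S. (\<Sum>g\<leftarrow>moves i. w i (g s)) * F s)"
    by (induction "moves i" rule: list.induct)
       (simp_all add: sum_list_sum_nth sum.swap[of _ S] sum_distrib_right)
  also have "\<dots> = of_nat (length (moves i)) * (\<mu> i * (\<Sum>s\<in>S. F s))"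
    using insert.prems(4) by (simp add: sum_distrib_left mult.assoc)
  finally have "(\<Sum>s\<in>S. w i s * F s) = \<mu> i * (\<Sum>s\<in>S. F s)"
    using insert.prems(3)[of i] by simp
  moreover have "(\<Sum>s\<in>S. F s) = of_nat (card S) * (\<Prod>i\<in>J. \<mu> i)"
    unfolding F_def
  proof (rule insert.IH)
    show "bij_betw g S S" if "k \<in> J" "g \<in> set (moves k)" for k g
      using that insert.prems(1)[of k g] by simp
    show "w l (g s) = w l s"
      if "k \<in> J" "l \<in> J" "l \<noteq> k" "g \<in> set (moves k)" "s \<in> S" for k l g s
      using that insert.prems(2)[of k l g s] by simp
    show "moves k \<noteq> []" if "k \<in> J" for k
      using that insert.prems(3)[of k] by simp
    show "(\<Sum>g\<leftarrow>moves k. w k (g s)) = of_nat (length (moves k)) * \<mu> k" if "k \<in> J" "s \<in> S" for k s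
      using that insert.prems(4)[of k s] by simp
  qed
  ultimately show ?case
    using insert.hyps by (simp add: F_def mult_ac)
qed

section \<open>Signed permutations\<close>

text \<open>
  The signed permutation whose entry at a positive position \<open>j\<close> has absolute value \<open>\<pi> j\<close> and is
  negative for \<open>j \<in> A\<close>. It serves both to count \<open>B\<^sub>n\<close> and to describe the symmetries of a block.
\<close>
definition signed_perm :: "(int \<Rightarrow> int) \<Rightarrow> int set \<Rightarrow> int \<Rightarrow> int" where
  "signed_perm \<pi> A i = sgn i * (if \<bar>i\<bar> \<in> A then - 1 else 1) * \<pi> \<bar>i\<bar>"

lemma signed_perm_pos: "i > 0 \<Longrightarrow> signed_perm \<pi> A i = (if i \<in> A then - \<pi> i else \<pi> i)"
  by (simp add: signed_perm_def)

lemma hyperoctahedral_0: "\<sigma> \<in> hyperoctahedral n \<Longrightarrow> \<sigma> 0 = 0"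
  by (auto simp: hyperoctahedral_def permutes_def)

lemma hyperoctahedral_minus: "\<sigma> \<in> hyperoctahedral n \<Longrightarrow> \<sigma> (- i) = - \<sigma> i"
  by (auto simp: hyperoctahedral_def)

lemma hyperoctahedral_inj: "\<sigma> \<in> hyperoctahedral n \<Longrightarrow> inj \<sigma>"
  by (auto simp: hyperoctahedral_def intro: permutes_inj)

lemma hyperoctahedral_nonzero: "\<sigma> \<in> hyperoctahedral n \<Longrightarrow> i \<noteq> 0 \<Longrightarrow> \<sigma> i \<noteq> 0"
  using hyperoctahedral_0 hyperoctahedral_inj by (metis injD)

lemma hyperoctahedral_abs_neq:
  assumes "\<sigma> \<in> hyperoctahedral n" "\<bar>i\<bar> \<noteq> \<bar>j\<bar>"
  shows "\<bar>\<sigma> i\<bar> \<noteq> \<bar>\<sigma> j\<bar>"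
proof
  assume "\<bar>\<sigma> i\<bar> = \<bar>\<sigma> j\<bar>"
  then have "\<sigma> i = \<sigma> j \<or> \<sigma> i = \<sigma> (- j)"
    using hyperoctahedral_minus[OF assms(1), of j] by (simp add: abs_eq_iff)
  then have "i = j \<or> i = - j"
    using hyperoctahedral_inj[OF assms(1)] by (blast dest: injD)
  then show False using assms(2) by auto
qed

lemma hyperoctahedral_comp:
  "\<sigma> \<in> hyperoctahedral n \<Longrightarrow> \<tau> \<in> hyperoctahedral n \<Longrightarrow> \<sigma> \<circ> \<tau> \<in> hyperoctahedral n"
  by (auto simp: hyperoctahedral_def intro: permutes_compose)

lemma bij_betw_comp_hyperoctahedral:
  assumes "\<tau> \<in> hyperoctahedral n"
  shows "bij_betw (\<lambda>\<sigma>. \<sigma> \<circ> \<tau>) (hyperoctahedral n) (hyperoctahedral n)"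
proof -
  have "surj \<tau>" using assms by (auto simp: hyperoctahedral_def dest: permutes_surj)
  then have "inj_on (\<lambda>\<sigma>. \<sigma> \<circ> \<tau>) (hyperoctahedral n)"
    by (simp add: inj_on_def fun.inj_map_strong) (metis surj_fun_eq)
  moreover have "(\<lambda>\<sigma>. \<sigma> \<circ> \<tau>) ` hyperoctahedral n \<subseteq> hyperoctahedral n"
    using assms hyperoctahedral_comp by auto
  ultimately show ?thesis
    using finite_hyperoctahedral by (simp add: bij_betw_def endo_inj_surj)
qed

lemma signed_perm_hyperoctahedral:
  assumes \<pi>: "\<pi> permutes {1..int n}" and A: "A \<subseteq> {1..int n}"
  shows "signed_perm \<pi> A \<in> hyperoctahedral n"
proof -
  have range: "\<pi> j \<in> {1..int n} \<longleftrightarrow> j \<in> {1..int n}" for j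
    using permutes_in_image[OF \<pi>] by blast
  have pos: "\<pi> j > 0" if "j > 0" for j
    using range[of j] that permutes_not_in[OF \<pi>, of j] by (cases "j \<in> {1..int n}") auto
  have abs: "\<bar>signed_perm \<pi> A i\<bar> = (if i = 0 then 0 else \<pi> \<bar>i\<bar>)" for i
    using pos[of "\<bar>i\<bar>"] by (auto simp: signed_perm_def abs_mult abs_sgn_eq)
  have "inj (signed_perm \<pi> A)"
  proof (rule injI)
    fix i j assume eq: "signed_perm \<pi> A i = signed_perm \<pi> A j"
    have zero: "i = 0 \<longleftrightarrow> j = 0"
      using abs[of i] abs[of j] eq pos[of "\<bar>i\<bar>"] pos[of "\<bar>j\<bar>"] by (force split: if_splits)
    show "i = j"
    proof (cases "j = 0")
      case False
      then have "\<pi> \<bar>i\<bar> = \<pi> \<bar>j\<bar>"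
        using zero abs[of i] abs[of j] eq by simp
      then have abs_eq: "\<bar>i\<bar> = \<bar>j\<bar>"
        using permutes_inj[OF \<pi>] by (blast dest: injD)
      then have "sgn i * c = sgn j * c"
        if "c = (if \<bar>j\<bar> \<in> A then - 1 else 1) * \<pi> \<bar>j\<bar>" for c
        using eq that unfolding signed_perm_def by (simp only: mult.assoc)
      then have "sgn i = sgn j"
        using pos[of "\<bar>j\<bar>"] False by (simp split: if_splits)
      then show ?thesis
        using abs_eq by (metis mult_sgn_abs)
    qed (use zero in simp)
  qed
  moreover have "signed_perm \<pi> A i \<in> {- int n..int n} - {0}" if "i \<in> {- int n..int n} - {0}" for i
    using abs[of i] range[of "\<bar>i\<bar>"] that by auto
  moreover have "signed_perm \<pi> A i = i" if "i \<notin> {- int n..int n} - {0}" for i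
  proof -
    have "\<bar>i\<bar> \<notin> {1..int n}" using that by auto
    then show ?thesis using A permutes_not_in[OF \<pi>, of "\<bar>i\<bar>"]
      by (auto simp: signed_perm_def mult_sgn_abs)
  qed
  ultimately have "signed_perm \<pi> A permutes ({- int n..int n} - {0})"
    by (intro inj_imp_permutes) (auto intro: inj_on_subset)
  then show ?thesis
    by (simp add: hyperoctahedral_def signed_perm_def sgn_minus)
qed

text \<open>
  A signed permutation is determined by the permutation of absolute values and the set of positions
  with a negative entry, and both can be prescribed freely.
\<close>
lemma card_hyperoctahedral: "card (hyperoctahedral n) = 2 ^ n * fact n"
proof -
  let ?I = "{1..int n}"
  let ?dom = "{\<pi>. \<pi> permutes ?I} \<times> Pow ?I"
  define enc where "enc \<sigma> = ((\<lambda>j. if j \<in> ?I then \<bar>\<sigma> j\<bar> else j), {j \<in> ?I. \<sigma> j < 0})"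
    for \<sigma> :: "int \<Rightarrow> int"
  have enc: "enc \<sigma> \<in> ?dom" if \<sigma>: "\<sigma> \<in> hyperoctahedral n" for \<sigma>
  proof -
    have perm: "\<sigma> permutes ({- int n..int n} - {0})"
      using \<sigma> by (simp add: hyperoctahedral_def)
    have maps: "\<bar>\<sigma> j\<bar> \<in> ?I" if "j \<in> ?I" for j
      using that permutes_in_image[OF perm, of j] by auto
    have "inj (\<lambda>j. if j \<in> ?I then \<bar>\<sigma> j\<bar> else j)"
    proof (rule injI)
      fix i j assume "(if i \<in> ?I then \<bar>\<sigma> i\<bar> else i) = (if j \<in> ?I then \<bar>\<sigma> j\<bar> else j)"
      then show "i = j"
        using hyperoctahedral_abs_neq[OF \<sigma>, of i j] maps[of i] maps[of j]
        by (auto split: if_splits)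
    qed
    then have "(\<lambda>j. if j \<in> ?I then \<bar>\<sigma> j\<bar> else j) permutes ?I"
      using maps by (intro inj_imp_permutes)
        (auto simp del: atLeastAtMost_iff intro: inj_on_subset)
    then show ?thesis by (auto simp: enc_def)
  qed
  have "bij_betw (\<lambda>(\<pi>, A). signed_perm \<pi> A) ?dom (hyperoctahedral n)"
  proof (rule bij_betw_byWitness[where f' = enc])
    show "\<forall>a\<in>?dom. enc ((\<lambda>(\<pi>, A). signed_perm \<pi> A) a) = a"
    proof safe
      fix \<pi> A assume \<pi>: "\<pi> permutes ?I" and A: "A \<subseteq> ?I"
      have pos: "\<pi> j > 0" if "j \<in> ?I" for j
        using that permutes_in_image[OF \<pi>, of j] by auto
      show "enc (signed_perm \<pi> A) = (\<pi>, A)"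
        using A pos permutes_not_in[OF \<pi>]
        by (fastforce simp: enc_def signed_perm_pos fun_eq_iff split: if_splits)
    qed
    show "\<forall>\<sigma>\<in>hyperoctahedral n. (\<lambda>(\<pi>, A). signed_perm \<pi> A) (enc \<sigma>) = \<sigma>"
    proof
      fix \<sigma> assume \<sigma>: "\<sigma> \<in> hyperoctahedral n"
      have "(case enc \<sigma> of (\<pi>, A) \<Rightarrow> signed_perm \<pi> A) i = \<sigma> i" for i
      proof -
        have fixed: "\<sigma> i = i" if "\<bar>i\<bar> > int n"
          using \<sigma> that by (intro permutes_not_in[of \<sigma> "{- int n..int n} - {0}"])
            (auto simp: hyperoctahedral_def)
        show ?thesis
          using fixed hyperoctahedral_0[OF \<sigma>] hyperoctahedral_minus[OF \<sigma>, of i]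
          by (cases i "0::int" rule: linorder_cases) (auto simp: enc_def signed_perm_def)
      qed
      then show "(case enc \<sigma> of (\<pi>, A) \<Rightarrow> signed_perm \<pi> A) = \<sigma>" ..
    qed
    show "(\<lambda>(\<pi>, A). signed_perm \<pi> A) ` ?dom \<subseteq> hyperoctahedral n"
      by (auto intro: signed_perm_hyperoctahedral)
    show "enc ` hyperoctahedral n \<subseteq> ?dom"
      using enc by blast
  qed
  then have "card (hyperoctahedral n) = card ?dom"
    by (simp add: bij_betw_same_card)
  also have "\<dots> = fact n * 2 ^ n"
    by (simp add: card_cartesian_product card_permutations[of ?I n] card_Pow)
  finally show ?thesis by simp
qed

lemma abs_last_of_nat:
  "n > 0 \<Longrightarrow> abs_last n \<sigma> (int i) = (if i = n then \<bar>\<sigma> (int i)\<bar> else \<sigma> (int i))"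
  by (auto simp: abs_last_def)

text \<open>
  Changing the sign of the last entry does not affect \<open>abs_last\<close> and flips the parity of the number of
  negative entries, so that \<open>D\<^sub>n\<close> and its complement in \<open>B\<^sub>n\<close> contribute equally.
\<close>
lemma sum_even_signed_abs_last:
  fixes F :: "(int \<Rightarrow> int) \<Rightarrow> 'a :: field_char_0"
  assumes "n > 0"
  shows "(\<Sum>\<sigma>\<in>even_signed n. F (abs_last n \<sigma>)) = (\<Sum>\<sigma>\<in>hyperoctahedral n. F (abs_last n \<sigma>)) / 2"
proof -
  let ?B = "hyperoctahedral n" and ?f = "signed_perm id {int n}"
  let ?e = "\<lambda>\<sigma>. even (card (Neg n \<sigma>))"
  have f: "?f \<in> ?B"
    using assms by (intro signed_perm_hyperoctahedral) (auto simp: permutes_id)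
  have last: "abs_last n (\<sigma> \<circ> ?f) = abs_last n \<sigma>" and parity: "?e (\<sigma> \<circ> ?f) \<longleftrightarrow> \<not> ?e \<sigma>"
    if \<sigma>: "\<sigma> \<in> ?B" for \<sigma>
  proof -
    have val: "(\<sigma> \<circ> ?f) i = (if \<bar>i\<bar> = int n then - \<sigma> i else \<sigma> i)" for i
      using hyperoctahedral_minus[OF \<sigma>, of i] by (auto simp: signed_perm_def abs_if sgn_if)
    show "abs_last n (\<sigma> \<circ> ?f) = abs_last n \<sigma>"
      unfolding abs_last_def using val by (auto simp: fun_eq_iff abs_if)
    let ?N = "Neg n \<sigma> - {n}"
    have fin: "finite ?N" by (simp add: Neg_def)
    have nz: "\<sigma> (int n) \<noteq> 0" using hyperoctahedral_nonzero[OF \<sigma>] assms by simp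
    have "Neg n \<sigma> = (if \<sigma> (int n) < 0 then insert n ?N else ?N)"
      using assms by (auto simp: Neg_def)
    moreover have "Neg n (\<sigma> \<circ> ?f) = (if \<sigma> (int n) < 0 then ?N else insert n ?N)"
      using assms nz by (auto simp: Neg_def val simp del: comp_apply)
    ultimately show "?e (\<sigma> \<circ> ?f) \<longleftrightarrow> \<not> ?e \<sigma>"
      using fin by (metis (full_types) Diff_iff card_insert_disjoint even_Suc insertI1)
  qed
  have even: "(\<Sum>\<sigma>\<in>even_signed n. F (abs_last n \<sigma>))
      = (\<Sum>\<sigma>\<in>?B. if ?e \<sigma> then F (abs_last n \<sigma>) else 0)"
    unfolding even_signed_def by (rule sum.inter_filter[OF finite_hyperoctahedral])
  also have "\<dots> = (\<Sum>\<sigma>\<in>?B. if ?e (\<sigma> \<circ> ?f) then F (abs_last n (\<sigma> \<circ> ?f)) else 0)"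
    by (rule sum.reindex_bij_betw[OF bij_betw_comp_hyperoctahedral[OF f], symmetric])
  also have "\<dots> = (\<Sum>\<sigma>\<in>?B. if ?e \<sigma> then 0 else F (abs_last n \<sigma>))"
    by (intro sum.cong) (simp_all add: last parity)
  finally have "2 * (\<Sum>\<sigma>\<in>even_signed n. F (abs_last n \<sigma>)) =
      (\<Sum>\<sigma>\<in>?B. if ?e \<sigma> then F (abs_last n \<sigma>) else 0)
      + (\<Sum>\<sigma>\<in>?B. if ?e \<sigma> then 0 else F (abs_last n \<sigma>))"
    using even by simp
  also have "\<dots> = (\<Sum>\<sigma>\<in>?B. F (abs_last n \<sigma>))"
    unfolding sum.distrib[symmetric] by (intro sum.cong) auto
  finally show ?thesis by (simp add: field_simps)
qed

section \<open>The weight of a position\<close>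

definition pair_weight :: "'a \<Rightarrow> 'a \<Rightarrow> int \<Rightarrow> int \<Rightarrow> 'a :: comm_semiring_1" where
  "pair_weight d s a b = (if a > b then d else 1) * (if a < 0 then s else 1)"

text \<open>
  The exponent \<open>2 * ((i + 1) div 2)\<close> is \<open>i + 1\<close> at an odd position and \<open>i\<close> at an even one, which is twice
  the contribution of a descent at \<open>i\<close> to \<open>omaj\<close> and to \<open>emaj\<close>. One weight thus serves both parities.
\<close>
definition position_weight ::
    "'a \<Rightarrow> 'a \<Rightarrow> 'a \<Rightarrow> nat \<Rightarrow> nat \<Rightarrow> (int \<Rightarrow> int) \<Rightarrow> 'a :: field_char_0" where
  "position_weight x y z n i \<tau> =
     (if i < n \<and> \<tau> (int i) > \<tau> (int (i + 1)) then y * x ^ (2 * ((i + 1) div 2)) else 1) *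
     (if \<tau> (int i) < 0 then x * z else 1)"

text \<open>
  For \<open>P\<close> the descents and \<open>Q\<close> the negative entries, this is the passage from the additive statistics to
  a product of local weights.
\<close>
lemma stat_monomial_eq_prod:
  fixes x y z :: "'a :: comm_semiring_1"
  assumes "finite J"
  shows "x ^ (2 * (\<Sum>i\<in>{i \<in> J. P i}. h i) + card {i \<in> J. Q i}) * y ^ card {i \<in> J. P i} *
           z ^ card {i \<in> J. Q i}
         = (\<Prod>i\<in>J. (if P i then y * x ^ (2 * h i) else 1) * (if Q i then x * z else 1))"
  using assms
  by (simp add: prod.distrib prod.inter_filter[symmetric] power_sum[symmetric] power_add
      sum_distrib_left power_mult_distrib mult_ac)

lemma odd_stats_eq_prod:
  "x ^ ofmaj n \<tau> * y ^ odes n \<tau> * z ^ oneg n \<tau>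
     = (\<Prod>i\<in>{i \<in> {..n}. odd i}. position_weight x y z n i \<tau>)"
proof -
  let ?J = "{i \<in> {..n}. odd i}"
  have des: "odd_part (Des n \<tau>) = {i \<in> ?J. i < n \<and> \<tau> (int i) > \<tau> (int (i + 1))}"
    by (auto simp: odd_part_def Des_def)
  have neg: "odd_part (Neg n \<tau>) = {i \<in> ?J. \<tau> (int i) < 0}"
    by (auto simp: odd_part_def Neg_def elim: oddE)
  show ?thesis
    unfolding ofmaj_def omaj_def odes_def oneg_def position_weight_def des neg
    by (rule stat_monomial_eq_prod) simp
qed

text \<open>
  Position 0 belongs to the product because it can be a descent. It is not an element of \<open>Neg\<close>, and
  \<open>\<tau> 0 = 0\<close> ensures that its weight does not count a negative entry either.
\<close>
lemma even_stats_eq_prod: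
  assumes "\<tau> 0 = 0"
  shows "x ^ efmaj n \<tau> * y ^ edes n \<tau> * z ^ eneg n \<tau>
     = (\<Prod>i\<in>{i \<in> {..n}. even i}. position_weight x y z n i \<tau>)"
proof -
  let ?J = "{i \<in> {..n}. even i}"
  have des: "even_part (Des n \<tau>) = {i \<in> ?J. i < n \<and> \<tau> (int i) > \<tau> (int (i + 1))}"
    by (auto simp: even_part_def Des_def)
  have neg: "even_part (Neg n \<tau>) = {i \<in> ?J. \<tau> (int i) < 0}"
    using assms by (auto simp: even_part_def Neg_def Suc_le_eq intro: gr0I)
  have "emaj n \<tau> = (\<Sum>i\<in>even_part (Des n \<tau>). (i + 1) div 2)"
    unfolding emaj_def by (intro sum.cong) (auto simp: even_part_def elim: evenE)
  then have emaj: "emaj n \<tau> = (\<Sum>i\<in>{i \<in> ?J. i < n \<and> \<tau> (int i) > \<tau> (int (i + 1))}. (i + 1) div 2)"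
    unfolding des .
  show ?thesis
    unfolding efmaj_def edes_def eneg_def position_weight_def emaj unfolding des neg
    by (rule stat_monomial_eq_prod) simp
qed

section \<open>Block averages\<close>

text \<open>
  The symmetries of the block \<open>{i, i + 1}\<close> of positions between 1 and \<open>n\<close>: in general all signed
  permutations of the block. Only the sign of the first entry is changed if \<open>i = 0\<close>, since position 0 is
  fixed. The identity is the only move if \<open>i = n\<close>, where the weight after \<open>abs_last\<close> is constantly 1.
\<close>
definition block_moves :: "nat \<Rightarrow> nat \<Rightarrow> ((int \<Rightarrow> int) \<Rightarrow> (int \<Rightarrow> int)) list" where
  "block_moves n i =
     (if i = n then [\<lambda>\<sigma>. \<sigma>]
      else if i = 0 then map (\<lambda>A \<sigma>. \<sigma> \<circ> signed_perm id A) [{}, {1}]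
      else map (\<lambda>(\<pi>, A) \<sigma>. \<sigma> \<circ> signed_perm \<pi> A)
        (List.product [id, transpose (int i) (int i + 1)]
           [{}, {int i}, {int i + 1}, {int i, int i + 1}]))"

text \<open>
  In the case \<open>i + 1 = n\<close> the sign of the second entry is lost, which leaves four equally likely
  outcomes instead of eight.
\<close>
definition block_average :: "'a \<Rightarrow> 'a \<Rightarrow> 'a \<Rightarrow> nat \<Rightarrow> nat \<Rightarrow> 'a :: field_char_0" where
  "block_average x y z n i =
     (let d = y * x ^ (2 * ((i + 1) div 2)); s = x * z
      in if i = n then 1
         else if i = 0 then (1 + y) / 2
         else if i + 1 = n then (1 + 2 * s + d) / 4
         else (1 + 3 * s + 3 * d + s * d) / 8)"

lemma block_moves_cases:
  assumes "g \<in> set (block_moves n i)" "i \<le> n"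
  obtains \<tau> where "\<tau> \<in> hyperoctahedral n" "g = (\<lambda>\<sigma>. \<sigma> \<circ> \<tau>)"
    "\<And>k. k \<noteq> i \<Longrightarrow> k \<noteq> i + 1 \<Longrightarrow> \<tau> (int k) = int k"
proof (cases "i = n")
  case True
  then show ?thesis
    using assms that[of id] by (auto simp: block_moves_def hyperoctahedral_def permutes_id)
next
  case False
  define T where "T = (if i = 0 then {int i + 1} else {int i, int i + 1})"
  from False obtain \<pi> A where g: "g = (\<lambda>\<sigma>. \<sigma> \<circ> signed_perm \<pi> A)"
    and \<pi>: "\<pi> permutes T" and A: "A \<subseteq> T"
    using assms(1)
    by (auto simp: block_moves_def T_def permutes_id split: if_splits
        intro: permutes_swap_id)
  have T: "T \<subseteq> {1..int n}" using False assms(2) by (auto simp: T_def)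
  have "signed_perm \<pi> A (int k) = int k" if "k \<noteq> i" "k \<noteq> i + 1" for k
  proof -
    have "int k \<notin> T" using that by (auto simp: T_def)
    then show ?thesis
      using A permutes_not_in[OF \<pi>] by (auto simp: signed_perm_def)
  qed
  then show ?thesis
    using that[OF _ g] signed_perm_hyperoctahedral[OF permutes_subset[OF \<pi> T]] A T by blast
qed

text \<open>
  The eight chambers of the hyperplane arrangement of type \<open>B\<^sub>2\<close>: in each of them the signs and the
  relative order of \<open>a\<close>, \<open>b\<close> and their negatives are all decided.
\<close>
lemma signed_pair_cases:
  fixes a b :: int
  assumes "\<bar>a\<bar> \<noteq> \<bar>b\<bar>" "a \<noteq> 0" "b \<noteq> 0"
  obtains "0 < a" "a < b" | "0 < a" "b < - a" | "a < 0" "- a < b" | "a < 0" "b < a"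
    | "0 < b" "b < a" | "0 < b" "a < - b" | "b < 0" "- b < a" | "b < 0" "a < b"
proof -
  consider "0 < a" "0 < b" | "0 < a" "b < 0" | "a < 0" "0 < b" | "a < 0" "b < 0"
    using assms(2,3) by (meson linorder_neqE)
  then show thesis
    using assms(1) that by cases (auto simp: abs_if elim!: linorder_neqE)
qed

lemma sum_pair_weight:
  fixes d s :: "'a :: comm_ring_1"
  assumes "\<bar>a\<bar> \<noteq> \<bar>b\<bar>" "a \<noteq> 0" "b \<noteq> 0"
  shows "pair_weight d s a b + pair_weight d s (- a) b + pair_weight d s a (- b)
         + pair_weight d s (- a) (- b) + pair_weight d s b a + pair_weight d s (- b) a
         + pair_weight d s b (- a) + pair_weight d s (- b) (- a) = 1 + 3 * s + 3 * d + s * d"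
proof -
  from assms show ?thesis
    by (cases rule: signed_pair_cases) (simp_all add: pair_weight_def)
qed

lemma sum_pair_weight_abs:
  fixes d s :: "'a :: comm_ring_1"
  assumes "\<bar>a\<bar> \<noteq> \<bar>b\<bar>" "a \<noteq> 0" "b \<noteq> 0"
  shows "pair_weight d s a \<bar>b\<bar> + pair_weight d s (- a) \<bar>b\<bar> + pair_weight d s b \<bar>a\<bar>
         + pair_weight d s (- b) \<bar>a\<bar> = 1 + 2 * s + d"
proof -
  from assms show ?thesis
    by (cases rule: signed_pair_cases) (simp_all add: pair_weight_def)
qed

lemma sum_block_moves:
  fixes x y z :: "'a :: field_char_0"
  assumes \<sigma>: "\<sigma> \<in> hyperoctahedral n" and "i \<le> n" and "n \<ge> 2"
  shows "(\<Sum>g\<leftarrow>block_moves n i. position_weight x y z n i (abs_last n (g \<sigma>)))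
         = of_nat (length (block_moves n i)) * block_average x y z n i"
proof -
  consider "i = n" | "i = 0" "i \<noteq> n" | "i > 0" "i < n"
    using assms by linarith
  then show ?thesis
  proof cases
    case 1
    then show ?thesis
      using \<open>n \<ge> 2\<close> by (simp add: block_moves_def block_average_def position_weight_def abs_last_of_nat)
  next
    case 2
    have "\<sigma> 1 \<noteq> 0" "\<sigma> 0 = 0" "\<sigma> (- 1) = - \<sigma> 1"
      using hyperoctahedral_nonzero[OF \<sigma>] hyperoctahedral_0[OF \<sigma>] hyperoctahedral_minus[OF \<sigma>]
      by simp_all
    then show ?thesis
      using 2 abs_last_of_nat[of n _ 0] abs_last_of_nat[of n _ 1] \<open>n \<ge> 2\<close>
      by (auto simp: block_moves_def block_average_def position_weight_def signed_perm_def)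
  next
    case 3
    define a b where "a = \<sigma> (int i)" and "b = \<sigma> (int i + 1)"
    define d where "d = y * x ^ (2 * ((i + 1) div 2))"
    have ab: "\<bar>a\<bar> \<noteq> \<bar>b\<bar>" "a \<noteq> 0" "b \<noteq> 0"
      using hyperoctahedral_nonzero[OF \<sigma>] hyperoctahedral_abs_neq[OF \<sigma>, of "int i" "int i + 1"] 3
      by (auto simp: a_def b_def)
    have minus: "\<sigma> (- int i) = - a" "\<sigma> (- (int i + 1)) = - b" "\<sigma> (- int i - 1) = - b"
      using hyperoctahedral_minus[OF \<sigma>, of "int i"] hyperoctahedral_minus[OF \<sigma>, of "int i + 1"]
      by (simp_all add: a_def b_def)
    have weight: "position_weight x y z n i (abs_last n \<tau>)
        = pair_weight d (x * z) (\<tau> (int i))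
            (if i + 1 = n then \<bar>\<tau> (int i + 1)\<bar> else \<tau> (int i + 1))" for \<tau>
    proof -
      have "abs_last n \<tau> (int i) = \<tau> (int i)"
        and "abs_last n \<tau> (int (i + 1))
          = (if i + 1 = n then \<bar>\<tau> (int i + 1)\<bar> else \<tau> (int i + 1))"
        using 3 abs_last_of_nat[of n \<tau> i] abs_last_of_nat[of n \<tau> "i + 1"]
        by (auto simp: add.commute)
      then show ?thesis
        unfolding position_weight_def pair_weight_def d_def using 3 by (simp only: simp_thms)
    qed
    have moves: "(\<Sum>g\<leftarrow>block_moves n i. H (g \<sigma> (int i)) (g \<sigma> (int i + 1))) =
        H a b + H (- a) b + H a (- b) + H (- a) (- b) + H b a + H (- b) a + H b (- a) + H (- b) (- a)"
      for H :: "int \<Rightarrow> int \<Rightarrow> 'a"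
      using 3 by (simp add: block_moves_def signed_perm_pos minus a_def[symmetric] b_def[symmetric]
          add.assoc)
    have length: "length (block_moves n i) = 8"
      using 3 by (simp add: block_moves_def)
    show ?thesis
    proof (cases "i + 1 = n")
      case True
      have "(\<Sum>g\<leftarrow>block_moves n i. position_weight x y z n i (abs_last n (g \<sigma>)))
          = (\<Sum>g\<leftarrow>block_moves n i. pair_weight d (x * z) (g \<sigma> (int i)) \<bar>g \<sigma> (int i + 1)\<bar>)"
        by (simp only: weight True simp_thms if_True)
      also have "\<dots> = 2 * (1 + 2 * (x * z) + d)"
        unfolding moves[of "\<lambda>v w. pair_weight d (x * z) v \<bar>w\<bar>"]
          sum_pair_weight_abs[OF ab, of d "x * z", symmetric] by (simp add: algebra_simps)
      also have "\<dots> = of_nat (length (block_moves n i)) * block_average x y z n i"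
        using 3 True by (simp add: block_average_def Let_def length d_def del: of_nat_Suc)
      finally show ?thesis .
    next
      case False
      have "(\<Sum>g\<leftarrow>block_moves n i. position_weight x y z n i (abs_last n (g \<sigma>)))
          = (\<Sum>g\<leftarrow>block_moves n i. pair_weight d (x * z) (g \<sigma> (int i)) (g \<sigma> (int i + 1)))"
        by (simp only: weight False if_False)
      also have "\<dots> = 1 + 3 * (x * z) + 3 * d + x * z * d"
        unfolding moves[of "pair_weight d (x * z)"] using sum_pair_weight[OF ab, of d "x * z"] .
      also have "\<dots> = of_nat (length (block_moves n i)) * block_average x y z n i"
        using 3 False by (simp add: block_average_def Let_def length d_def)
      finally show ?thesis .
    qed
  qed
qed

text \<open>
  No two consecutive positions may lie in \<open>J\<close>, for otherwise their blocks overlap and the moves of one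
  block would change the weight of the other.
\<close>
lemma sum_even_signed_prod_position_weight:
  fixes x y z :: "'a :: field_char_0"
  assumes "n \<ge> 2" and J: "J \<subseteq> {..n}" and sparse: "\<And>i. i \<in> J \<Longrightarrow> i + 1 \<notin> J"
  shows "(\<Sum>\<sigma>\<in>even_signed n. \<Prod>i\<in>J. position_weight x y z n i (abs_last n \<sigma>))
         = fact n * 2 ^ n / 2 * (\<Prod>i\<in>J. block_average x y z n i)"
proof -
  have "(\<Sum>\<sigma>\<in>hyperoctahedral n. \<Prod>i\<in>J. position_weight x y z n i (abs_last n \<sigma>))
      = of_nat (card (hyperoctahedral n)) * (\<Prod>i\<in>J. block_average x y z n i)"
  proof (rule sum_prod_local_average[where moves = "block_moves n"])
    show "finite J" using J finite_subset by blast
    show "block_moves n i \<noteq> []" for i by (simp add: block_moves_def)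
    show "bij_betw g (hyperoctahedral n) (hyperoctahedral n)"
      if "i \<in> J" "g \<in> set (block_moves n i)" for i g
      using that J by (auto elim!: block_moves_cases intro: bij_betw_comp_hyperoctahedral)
    show "(\<Sum>g\<leftarrow>block_moves n i. position_weight x y z n i (abs_last n (g \<sigma>)))
        = of_nat (length (block_moves n i)) * block_average x y z n i"
      if "i \<in> J" "\<sigma> \<in> hyperoctahedral n" for i \<sigma>
      using that J assms(1) by (intro sum_block_moves) auto
    show "position_weight x y z n k (abs_last n (g \<sigma>)) = position_weight x y z n k (abs_last n \<sigma>)"
      if ik: "i \<in> J" "k \<in> J" "k \<noteq> i" and g: "g \<in> set (block_moves n i)" for i k g \<sigma>
    proof -
      have "i \<le> n" using ik J by auto
      then obtain \<tau> where \<tau>: "g = (\<lambda>\<sigma>. \<sigma> \<circ> \<tau>)"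
        "\<And>k. k \<noteq> i \<Longrightarrow> k \<noteq> i + 1 \<Longrightarrow> \<tau> (int k) = int k"
        using block_moves_cases[OF g] by metis
      have "k \<noteq> i + 1" "k + 1 \<noteq> i" using sparse ik by auto
      then have "\<tau> (int k) = int k" "\<tau> (int (k + 1)) = int (k + 1)"
        using \<tau>(2)[of k] \<tau>(2)[of "k + 1"] ik by auto
      then have "abs_last n (g \<sigma>) (int k) = abs_last n \<sigma> (int k)"
        "abs_last n (g \<sigma>) (int (k + 1)) = abs_last n \<sigma> (int (k + 1))"
        using assms(1) abs_last_of_nat[of n _ k] abs_last_of_nat[of n _ "k + 1"] by (auto simp: \<tau>(1))
      then show ?thesis
        unfolding position_weight_def by (simp only:)
    qed
  qed
  then show ?thesis
    using assms(1) sum_even_signed_abs_last[of n "\<lambda>\<tau>. \<Prod>i\<in>J. position_weight x y z n i \<tau>"]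
    by (simp add: card_hyperoctahedral mult_ac)
qed

section \<open>The generating functions\<close>

lemma abs_last_0:
  assumes "n > 0" "\<sigma> \<in> even_signed n"
  shows "abs_last n \<sigma> 0 = 0"
  using assms abs_last_of_nat[of n \<sigma> 0] hyperoctahedral_0[of \<sigma> n] by (simp add: even_signed_def)

lemma parity_exp_eq: "parity_exp k = (if even k then 1 else 0)"
  by (simp add: parity_exp_def)

lemma prod_odd_atMost_even:
  fixes f :: "nat \<Rightarrow> 'a :: comm_monoid_mult"
  shows "(\<Prod>i\<in>{i \<in> {..2 * m}. odd i}. f i) = (\<Prod>j=1..m. f (2 * j - 1))"
  by (subst prod.inter_filter, simp, induction m) (simp_all add: mult_ac)

lemma prod_even_atMost_even:
  fixes f :: "nat \<Rightarrow> 'a :: comm_monoid_mult"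
  shows "(\<Prod>i\<in>{i \<in> {..2 * m}. even i}. f i) = f 0 * (\<Prod>j=1..m. f (2 * j))"
  by (subst prod.inter_filter, simp, induction m) (simp_all add: mult_ac)

lemma block_average_interior:
  assumes "j \<ge> 1" "i = 2 * j - 1 \<or> i = 2 * j" "i + 1 < n"
  shows "block_average x y z n i
         = (1 + 3 * x * z + 3 * y * x ^ (2 * j) + y * z * x ^ (2 * j + 1)) / 8"
proof -
  have "(i + 1) div 2 = j" "i \<noteq> 0" using assms by auto
  then show ?thesis
    using assms by (simp add: block_average_def Let_def mult_ac)
qed

lemma sum_odd_stats_D:
  fixes x y z :: "'a :: field_char_0"
  assumes "n \<ge> 2"
  shows "(\<Sum>\<sigma>\<in>even_signed n. x ^ oDmaj n \<sigma> * y ^ odes_D n \<sigma> * z ^ oneg_D n \<sigma>)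
         = fact n * 2 ^ n / 2 * (\<Prod>i\<in>{i \<in> {..n}. odd i}. block_average x y z n i)"
  unfolding oDmaj_def odes_D_def oneg_D_def odd_stats_eq_prod
  using assms by (intro sum_even_signed_prod_position_weight) auto

lemma sum_even_stats_D:
  fixes x y z :: "'a :: field_char_0"
  assumes "n \<ge> 2"
  shows "(\<Sum>\<sigma>\<in>even_signed n. x ^ eDmaj n \<sigma> * y ^ edes_D n \<sigma> * z ^ eneg_D n \<sigma>)
         = fact n * 2 ^ n / 2 * (\<Prod>i\<in>{i \<in> {..n}. even i}. block_average x y z n i)"
proof -
  have "(\<Sum>\<sigma>\<in>even_signed n. x ^ eDmaj n \<sigma> * y ^ edes_D n \<sigma> * z ^ eneg_D n \<sigma>)
      = (\<Sum>\<sigma>\<in>even_signed n. \<Prod>i\<in>{i \<in> {..n}. even i}. position_weight x y z n i (abs_last n \<sigma>))"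
    unfolding eDmaj_def edes_D_def eneg_D_def
  proof (rule sum.cong[OF refl])
    fix \<sigma> assume "\<sigma> \<in> even_signed n"
    then have "abs_last n \<sigma> 0 = 0"
      using assms by (intro abs_last_0) simp_all
    then show "x ^ efmaj n (abs_last n \<sigma>) * y ^ edes n (abs_last n \<sigma>) * z ^ eneg n (abs_last n \<sigma>)
        = (\<Prod>i\<in>{i \<in> {..n}. even i}. position_weight x y z n i (abs_last n \<sigma>))"
      by (rule even_stats_eq_prod)
  qed
  also have "\<dots> = fact n * 2 ^ n / 2 * (\<Prod>i\<in>{i \<in> {..n}. even i}. block_average x y z n i)"
    using assms by (intro sum_even_signed_prod_position_weight) auto
  finally show ?thesis .
qed

theorem theorem4p2:
  fixes n :: nat and x y z :: "'a :: field_char_0"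
  assumes "n \<ge> 3"
  shows "(\<Sum>\<sigma> \<in> even_signed n. x ^ oDmaj n \<sigma> * y ^ odes_D n \<sigma> * z ^ oneg_D n \<sigma>) =
           fact n / 2 ^ (n div 2) * (1 + 2 * z * x + y * x ^ n) ^ parity_exp n *
           (\<Prod>j = 1..(n - 1) div 2.
              1 + 3 * x * z + 3 * y * x ^ (2 * j) + y * z * x ^ (2 * j + 1)) \<and>
         (\<Sum>\<sigma> \<in> even_signed n. x ^ eDmaj n \<sigma> * y ^ edes_D n \<sigma> * z ^ eneg_D n \<sigma>) =
           fact n / 2 ^ ((n - 1) div 2) * (1 + y) *
           (1 + 2 * z * x + y * x ^ (n - 1)) ^ parity_exp (n + 1) *
           (\<Prod>j = 1..(n - 2) div 2.
              1 + 3 * z * x + 3 * y * x ^ (2 * j) + y * z * x ^ (2 * j + 1))"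
proof -
  define E where
    "E j = 1 + 3 * x * z + 3 * y * x ^ (2 * j) + y * z * x ^ (2 * j + 1)" for j
  define \<beta> where "\<beta> = block_average x y z n"
  have \<beta>_interior: "\<beta> i = E j / 8" if "j \<ge> 1" "i = 2 * j - 1 \<or> i = 2 * j" "i + 1 < n" for i j
    unfolding \<beta>_def E_def using that by (rule block_average_interior)
  have \<beta>_0: "\<beta> 0 = (1 + y) / 2" and \<beta>_n: "\<beta> n = 1"
    using assms unfolding \<beta>_def block_average_def Let_def by simp_all
  \<comment> \<open>The exponent is kept in this form because it becomes \<open>n\<close> for odd \<open>i\<close> and \<open>n - 1\<close> for even \<open>i\<close>.\<close>
  have \<beta>_penultimate: "\<beta> i = (1 + 2 * z * x + y * x ^ (2 * ((i + 1) div 2))) / 4" if "i + 1 = n" for i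
  proof -
    have "i \<noteq> n" "i \<noteq> 0" using that assms by auto
    then show ?thesis
      unfolding \<beta>_def block_average_def Let_def using that by (simp only: simp_thms if_False if_True mult_ac)
  qed
  \<comment> \<open>The cube of \<open>2 ^ k\<close> is written out so that it cancels against the powers of 2 from \<open>card B\<^sub>n\<close>.\<close>
  have scale: "(\<Prod>j=1..k. E j / 8) = (\<Prod>j=1..k. E j) / (2 ^ k * 2 ^ k * 2 ^ k)" for k
    by (simp add: prod_dividef flip: power_mult_distrib)
  have "n \<ge> 2" using assms by simp
  note odd_sum_eq = sum_odd_stats_D[OF this, of x y z, folded \<beta>_def]
    and even_sum_eq = sum_even_stats_D[OF this, of x y z, folded \<beta>_def]
  have odd_sum: "(\<Sum>\<sigma>\<in>even_signed n. x ^ oDmaj n \<sigma> * y ^ odes_D n \<sigma> * z ^ oneg_D n \<sigma>) =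
      fact n / 2 ^ (n div 2) * (1 + 2 * z * x + y * x ^ n) ^ parity_exp n *
      (\<Prod>j = 1..(n - 1) div 2. E j)"
  proof (cases "even n")
    case True
    then have "n = 2 * ((n div 2 - 1) + 1)" using assms by presburger
    then obtain k where n: "n = 2 * (k + 1)" ..
    have "(\<Prod>i\<in>{i \<in> {..n}. odd i}. \<beta> i) = (\<Prod>j=1..k. \<beta> (2 * j - 1)) * \<beta> (2 * k + 1)"
      unfolding n prod_odd_atMost_even by simp
    also have "(\<Prod>j=1..k. \<beta> (2 * j - 1)) = (\<Prod>j=1..k. E j / 8)"
      by (intro prod.cong[OF refl] \<beta>_interior) (auto simp: n)
    also have "\<beta> (2 * k + 1) = (1 + 2 * z * x + y * x ^ n) / 4"
      by (subst \<beta>_penultimate) (simp_all add: n)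
    finally have prod: "(\<Prod>i\<in>{i \<in> {..n}. odd i}. \<beta> i) =
        ((\<Prod>j=1..k. E j) / (2 ^ k * 2 ^ k * 2 ^ k)) *
        ((1 + 2 * z * x + y * x ^ n) / 4)"
      unfolding scale .
    have "n = k + k + 2" by (simp add: n)
    then have "(2 :: 'a) ^ n = 4 * (2 ^ k * 2 ^ k)"
      by (simp only: power_add) simp
    moreover have "(2 :: 'a) ^ (n div 2) = 2 * 2 ^ k" "(n - 1) div 2 = k" "parity_exp n = 1"
      by (simp_all add: n parity_exp_eq)
    ultimately show ?thesis
      unfolding odd_sum_eq prod by (simp add: field_simps)
  next
    case False
    then obtain k where n: "n = 2 * k + 1" by (auto elim!: oddE)
    \<comment> \<open>The last position is odd and stands alone, without a partner \<open>n + 1\<close>.\<close>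
    have positions: "{i \<in> {..n}. odd i} = insert n {i \<in> {..2 * k}. odd i}"
      by (auto simp: n le_Suc_eq)
    have "(\<Prod>i\<in>{i \<in> {..n}. odd i}. \<beta> i) = \<beta> n * (\<Prod>i\<in>{i \<in> {..2 * k}. odd i}. \<beta> i)"
      unfolding positions by (intro prod.insert) (auto simp: n)
    also have "\<dots> = (\<Prod>j=1..k. \<beta> (2 * j - 1))"
      unfolding prod_odd_atMost_even \<beta>_n by simp
    also have "\<dots> = (\<Prod>j=1..k. E j / 8)"
      by (intro prod.cong[OF refl] \<beta>_interior) (auto simp: n)
    finally have prod: "(\<Prod>i\<in>{i \<in> {..n}. odd i}. \<beta> i) =
        ((\<Prod>j=1..k. E j) / (2 ^ k * 2 ^ k * 2 ^ k))"
      unfolding scale .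
    have "n = k + k + 1" by (simp add: n)
    then have "(2 :: 'a) ^ n = 2 * (2 ^ k * 2 ^ k)"
      by (simp only: power_add) simp
    moreover have "n div 2 = k" "(n - 1) div 2 = k" "parity_exp n = 0"
      by (simp_all add: n parity_exp_eq)
    ultimately show ?thesis
      unfolding odd_sum_eq prod by (simp add: field_simps)
  qed
  have even_sum: "(\<Sum>\<sigma>\<in>even_signed n. x ^ eDmaj n \<sigma> * y ^ edes_D n \<sigma> * z ^ eneg_D n \<sigma>) =
      fact n / 2 ^ ((n - 1) div 2) * (1 + y) *
      (1 + 2 * z * x + y * x ^ (n - 1)) ^ parity_exp (n + 1) *
      (\<Prod>j = 1..(n - 2) div 2. E j)"
  proof (cases "even n")
    case True
    then have "n = 2 * ((n div 2 - 1) + 1)" using assms by presburger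
    then obtain k where n: "n = 2 * (k + 1)" ..
    have "(\<Prod>i\<in>{i \<in> {..n}. even i}. \<beta> i) = \<beta> 0 * (\<Prod>j=1..k. \<beta> (2 * j))"
      unfolding n prod_even_atMost_even using \<beta>_n by (simp add: n)
    also have "(\<Prod>j=1..k. \<beta> (2 * j)) = (\<Prod>j=1..k. E j / 8)"
      by (intro prod.cong[OF refl] \<beta>_interior) (auto simp: n)
    finally have prod: "(\<Prod>i\<in>{i \<in> {..n}. even i}. \<beta> i) =
        (1 + y) / 2 * ((\<Prod>j=1..k. E j) / (2 ^ k * 2 ^ k * 2 ^ k))"
      unfolding scale \<beta>_0 .
    have "n = k + k + 2" by (simp add: n)
    then have "(2 :: 'a) ^ n = 4 * (2 ^ k * 2 ^ k)"
      by (simp only: power_add) simp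
    moreover have "(n - 1) div 2 = k" "(n - 2) div 2 = k" "parity_exp (n + 1) = 0"
      by (simp_all add: n parity_exp_eq)
    ultimately show ?thesis
      unfolding even_sum_eq prod by (simp add: field_simps)
  next
    case False
    then have "n = 2 * ((n div 2 - 1) + 1) + 1" using assms by presburger
    then obtain k where n: "n = 2 * (k + 1) + 1" ..
    have "{i \<in> {..n}. even i} = {i \<in> {..2 * (k + 1)}. even i}"
      by (auto simp: n le_Suc_eq)
    then have "(\<Prod>i\<in>{i \<in> {..n}. even i}. \<beta> i) = \<beta> 0 * (\<Prod>j=1..k. \<beta> (2 * j)) * \<beta> (2 * k + 2)"
      using prod_even_atMost_even[of \<beta> "k + 1"] by (simp add: mult_ac)
    also have "(\<Prod>j=1..k. \<beta> (2 * j)) = (\<Prod>j=1..k. E j / 8)"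
      by (intro prod.cong[OF refl] \<beta>_interior) (auto simp: n)
    also have "\<beta> (2 * k + 2) = (1 + 2 * z * x + y * x ^ (n - 1)) / 4"
      by (subst \<beta>_penultimate) (simp_all add: n)
    finally have prod: "(\<Prod>i\<in>{i \<in> {..n}. even i}. \<beta> i) =
        (1 + y) / 2 * ((\<Prod>j=1..k. E j) / (2 ^ k * 2 ^ k * 2 ^ k)) *
        ((1 + 2 * z * x + y * x ^ (n - 1)) / 4)"
      unfolding scale \<beta>_0 .
    have "n = k + k + 3" by (simp add: n)
    then have "(2 :: 'a) ^ n = 8 * (2 ^ k * 2 ^ k)"
      by (simp only: power_add) simp
    moreover have "(2 :: 'a) ^ ((n - 1) div 2) = 2 * 2 ^ k" "(n - 2) div 2 = k" "parity_exp (n + 1) = 1"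
      by (simp_all add: n parity_exp_eq)
    ultimately show ?thesis
      unfolding even_sum_eq prod by (simp add: field_simps)
  qed
  have E_commuted: "E j = 1 + 3 * z * x + 3 * y * x ^ (2 * j) + y * z * x ^ (2 * j + 1)" for j
    by (simp add: E_def mult_ac)
  show ?thesis
    using odd_sum[unfolded E_def] even_sum[unfolded E_commuted] by (rule conjI)
qed

end
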